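(* James' space $J$ has the W.A.P. (weakly compact approximation property).
   Context: James' space $J$ is the Banach space of real sequences $x=(x_j)_{j\ge 1}$ with $\lim_{j\to\infty}x_j=0$ and $$\|x\|^2=\sup\sum_{j=1}^n |x_{p_{j+1}}-x_{p_j}|^2<\infty,$$ where the supremum is over all $n\in\mathbb N$ and all indices $1\le p_1<p_2<\dots<p_n<p_{n+1}$; $\|\cdot\|$ is its norm. A Banach space $E$ has the weakly compact approximation property (W.A.P.) if there is a constant $C<\infty$ such that for every weakly compact set $D\subset E$ and every $\varepsilon>0$ there is a weakly compact operator $V:E\to E$ with $\sup_{x\in D}\|x-Vx\|<\varepsilon$ and $\|V\|\le C$. *)

theory Defs
  imports "HOL-Analysis.Analysis"
begin

section \<open>Weak topology and the weakly compact approximation property\<close>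

definition weak_topology :: "'a::real_normed_vector topology"
  where "weak_topology =
    topology_generated_by {blinfun_apply f -` U |(f :: 'a \<Rightarrow>\<^sub>L real) U. open U}"

definition weakly_compact :: "'a::real_normed_vector set \<Rightarrow> bool"
  where "weakly_compact D \<longleftrightarrow> compactin weak_topology D"

definition weakly_compact_operator ::
    "('a::real_normed_vector \<Rightarrow>\<^sub>L 'b::real_normed_vector) \<Rightarrow> bool"
  where "weakly_compact_operator V \<longleftrightarrow>
    weakly_compact (weak_topology closure_of (blinfun_apply V ` cball 0 1))"

text \<open>
  The property of the Banach space \<open>'a\<close>, passed as a type. The supremum is taken in \<open>ereal\<close>, so
  that it is meaningful without a boundedness side condition; for \<open>D = {}\<close> it is \<open>-\<infinity>\<close>.
\<close>

definition WAP :: "'a::banach itself \<Rightarrow> bool"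
  where "WAP (_ :: 'a itself) \<longleftrightarrow>
    (\<exists>C::real. \<forall>D :: 'a set. weakly_compact D \<longrightarrow>
      (\<forall>\<epsilon>::real. \<epsilon> > 0 \<longrightarrow>
        (\<exists>V :: 'a \<Rightarrow>\<^sub>L 'a. weakly_compact_operator V \<and>
          (SUP x\<in>D. ereal (norm (x - blinfun_apply V x))) < ereal \<epsilon> \<and> norm V \<le> C)))"


section \<open>James' space\<close>

text \<open>
  Sequences are indexed from \<open>0\<close>: the coordinate \<open>x\<^sub>j\<close> (\<open>j \<ge> 1\<close>) is \<open>x (j - 1)\<close>, and the indices
  \<open>p\<^sub>1 < \<dots> < p\<^sub>n\<^sub>+\<^sub>1\<close> are \<open>p 0 < \<dots> < p n\<close>. The empty sum (\<open>n = 0\<close>) does not affect the supremum.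
\<close>

definition james_sums :: "(nat \<Rightarrow> real) \<Rightarrow> real set"
  where "james_sums x =
    {\<Sum>j<n. \<bar>x (p (Suc j)) - x (p j)\<bar>\<^sup>2 |p n. strict_mono_on {..n} p}"

definition james_norm :: "(nat \<Rightarrow> real) \<Rightarrow> real"
  where "james_norm x = sqrt (Sup (james_sums x))"

lemma james_sums_zero: "james_sums (\<lambda>_. 0) = {0}"
  by (auto simp: james_sums_def intro!: exI[of _ id] simp: strict_mono_on_def)

typedef james = "{x :: nat \<Rightarrow> real. x \<longlonglongrightarrow> 0 \<and> bdd_above (james_sums x)}"
  morphisms james_nth Abs_james
  by (rule exI[of _ "\<lambda>_. 0"]) (simp add: james_sums_zero)

setup_lifting type_definition_james

lemma james_nth_tendsto: "james_nth x \<longlonglongrightarrow> 0"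
  using james_nth[of x] by simp

lemma bdd_above_james_sums: "bdd_above (james_sums (james_nth x))"
  using james_nth[of x] by simp

definition james_l2 :: "(nat \<Rightarrow> real) \<Rightarrow> (nat \<Rightarrow> nat) \<Rightarrow> nat \<Rightarrow> real"
  where "james_l2 x p n = L2_set (\<lambda>j. x (p (Suc j)) - x (p j)) {..<n}"

lemma james_sums_l2: "james_sums x = {(james_l2 x p n)\<^sup>2 |p n. strict_mono_on {..n} p}"
  by (simp add: james_sums_def james_l2_def L2_set_def sum_nonneg)

lemma james_l2_nonneg [simp]: "0 \<le> james_l2 x p n"
  by (simp add: james_l2_def)

lemma strict_mono_on_Suc: "strict_mono_on {..n} Suc"
  by (simp add: strict_mono_on_def)

lemma james_sums_nonempty: "james_sums x \<noteq> {}"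
  by (auto simp: james_sums_def intro!: exI[of _ id] simp: strict_mono_on_def)

lemma bdd_james_sumsI:
  assumes "\<And>p n. strict_mono_on {..n} p \<Longrightarrow> james_l2 x p n \<le> B"
  shows "bdd_above (james_sums x)"
  by (rule bdd_aboveI[of _ "B\<^sup>2"]) (auto simp: james_sums_l2 intro!: power_mono assms)

lemma james_norm_upper:
  assumes "bdd_above (james_sums x)" "strict_mono_on {..n} p"
  shows "james_l2 x p n \<le> james_norm x"
  unfolding james_norm_def
  by (rule real_le_rsqrt, rule cSup_upper[OF _ assms(1)]) (use assms(2) in \<open>auto simp: james_sums_l2\<close>)

lemma james_norm_least:
  assumes "\<And>p n. strict_mono_on {..n} p \<Longrightarrow> james_l2 x p n \<le> B"
  shows "james_norm x \<le> B"
proof -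
  have "0 \<le> B"
    using assms[OF strict_mono_on_Suc] order_trans[OF james_l2_nonneg] by blast
  then show ?thesis
    unfolding james_norm_def
    by (intro real_le_lsqrt cSup_least james_sums_nonempty)
      (auto simp: james_sums_l2 intro!: power_mono assms)
qed

lemma james_norm_nonneg:
  assumes "bdd_above (james_sums x)"
  shows "0 \<le> james_norm x"
  by (rule order_trans[OF james_l2_nonneg james_norm_upper[OF assms strict_mono_on_Suc]])

lemma james_l2_add: "james_l2 (\<lambda>i. x i + y i) p n \<le> james_l2 x p n + james_l2 y p n"
  using L2_set_triangle_ineq[of "\<lambda>j. x (p (Suc j)) - x (p j)" "\<lambda>j. y (p (Suc j)) - y (p j)" "{..<n}"]
  by (simp add: james_l2_def algebra_simps)

lemma james_l2_scale: "james_l2 (\<lambda>i. c * x i) p n = \<bar>c\<bar> * james_l2 x p n"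
proof -
  have "(\<Sum>j<n. (c * x (p (Suc j)) - c * x (p j))\<^sup>2) = c\<^sup>2 * (\<Sum>j<n. (x (p (Suc j)) - x (p j))\<^sup>2)"
    by (simp add: sum_distrib_left power_mult_distrib flip: right_diff_distrib)
  then show ?thesis
    by (simp add: james_l2_def L2_set_def real_sqrt_mult)
qed

lemma james_norm_coord:
  assumes "x \<longlonglongrightarrow> 0" "bdd_above (james_sums x)"
  shows "\<bar>x i\<bar> \<le> james_norm x"
proof (rule LIMSEQ_le_const2)
  show "(\<lambda>k. \<bar>x k - x i\<bar>) \<longlonglongrightarrow> \<bar>x i\<bar>"
    using tendsto_rabs[OF tendsto_diff[OF assms(1) tendsto_const[of "x i"]]] by simp
  have "\<bar>x k - x i\<bar> \<le> james_norm x" if "k > i" for k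
  proof -
    have "strict_mono_on {..Suc 0} (\<lambda>j. if j = 0 then i else k)"
      using that by (auto simp: strict_mono_on_def)
    from james_norm_upper[OF assms(2) this] show ?thesis
      by (simp add: james_l2_def L2_set_def)
  qed
  then show "\<exists>N. \<forall>k\<ge>N. \<bar>x k - x i\<bar> \<le> james_norm x"
    by (intro exI[of _ "Suc i"]) auto
qed

lemma bdd_james_sums_add:
  assumes "bdd_above (james_sums x)" "bdd_above (james_sums y)"
  shows "bdd_above (james_sums (\<lambda>i. x i + y i))"
  by (rule bdd_james_sumsI[of _ "james_norm x + james_norm y"])
    (rule order_trans[OF james_l2_add add_mono[OF james_norm_upper[OF assms(1)] james_norm_upper[OF assms(2)]]])

lemma bdd_james_sums_scale:
  assumes "bdd_above (james_sums x)"
  shows "bdd_above (james_sums (\<lambda>i. c * x i))"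
  by (rule bdd_james_sumsI[of _ "\<bar>c\<bar> * james_norm x"])
    (auto simp: james_l2_scale intro!: mult_left_mono james_norm_upper assms)

instantiation james :: real_vector
begin

lift_definition zero_james :: james is "\<lambda>_. 0"
  by (simp add: james_sums_zero)

lift_definition plus_james :: "james \<Rightarrow> james \<Rightarrow> james" is "\<lambda>x y i. x i + y i"
  by (auto intro: tendsto_add_zero bdd_james_sums_add)

lift_definition scaleR_james :: "real \<Rightarrow> james \<Rightarrow> james" is "\<lambda>c x i. c * x i"
  by (auto intro: tendsto_mult_right_zero bdd_james_sums_scale)

lift_definition uminus_james :: "james \<Rightarrow> james" is "\<lambda>x i. - x i"
  using bdd_james_sums_scale[of _ "- 1"] by (auto intro: tendsto_minus_cancel)

lift_definition minus_james :: "james \<Rightarrow> james \<Rightarrow> james" is "\<lambda>x y i. x i - y i"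
proof -
  fix x y :: "nat \<Rightarrow> real"
  assume x: "x \<longlonglongrightarrow> 0 \<and> bdd_above (james_sums x)" and y: "y \<longlonglongrightarrow> 0 \<and> bdd_above (james_sums y)"
  then show "(\<lambda>i. x i - y i) \<longlonglongrightarrow> 0 \<and> bdd_above (james_sums (\<lambda>i. x i - y i))"
    using bdd_james_sums_add[OF _ bdd_james_sums_scale[of y "- 1"], of x]
      tendsto_diff[of x 0 sequentially y 0] by simp
qed

instance
  by standard (transfer; simp add: algebra_simps fun_eq_iff)+

end

lemmas james_nth_simps [simp] =
  zero_james.rep_eq plus_james.rep_eq scaleR_james.rep_eq uminus_james.rep_eq minus_james.rep_eq

lemma james_eqI: "(\<And>i. james_nth x i = james_nth y i) \<Longrightarrow> x = y"
  by (simp add: james_nth_inject[symmetric] fun_eq_iff)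

instantiation james :: real_normed_vector
begin

lift_definition norm_james :: "james \<Rightarrow> real" is james_norm .

definition dist_james :: "james \<Rightarrow> james \<Rightarrow> real"
  where "dist_james x y = norm (x - y)"

definition sgn_james :: "james \<Rightarrow> james"
  where "sgn_james x = inverse (norm x) *\<^sub>R x"

definition uniformity_james :: "(james \<times> james) filter"
  where "uniformity_james = (INF e\<in>{0 <..}. principal {(x, y). dist x y < e})"

definition open_james :: "james set \<Rightarrow> bool"
  where "open_james S = (\<forall>x\<in>S. \<forall>\<^sub>F (x', y) in uniformity. x' = x \<longrightarrow> y \<in> S)"

instance
proof
  fix x y :: james and c :: real
  note upper = james_norm_upper[OF bdd_above_james_sums]
  show "norm x = 0 \<longleftrightarrow> x = 0"
  proof
    assume "norm x = 0"
    then have "\<bar>james_nth x i\<bar> \<le> 0" for i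
      using james_norm_coord[OF james_nth_tendsto bdd_above_james_sums, of x i]
      by (simp add: norm_james.rep_eq)
    then show "x = 0"
      by (intro james_eqI) simp
  next
    assume "x = 0"
    then show "norm x = 0"
      by (simp add: norm_james.rep_eq james_norm_def james_sums_zero)
  qed
  show "norm (x + y) \<le> norm x + norm y"
    unfolding norm_james.rep_eq plus_james.rep_eq
    by (rule james_norm_least) (rule order_trans[OF james_l2_add add_mono[OF upper upper]])
  have le: "norm (c *\<^sub>R x) \<le> \<bar>c\<bar> * norm x" for c and x :: james
    unfolding norm_james.rep_eq scaleR_james.rep_eq
    by (rule james_norm_least)
      (auto simp: james_l2_scale intro!: mult_left_mono james_norm_upper bdd_above_james_sums)
  show "norm (c *\<^sub>R x) = \<bar>c\<bar> * norm x"
  proof (cases "c = 0")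
    case True
    have "0 \<le> norm (c *\<^sub>R x)"
      by (simp only: norm_james.rep_eq james_norm_nonneg[OF bdd_above_james_sums])
    with le[of c x] True show ?thesis by simp
  next
    case False
    have "norm x = norm (inverse c *\<^sub>R (c *\<^sub>R x))"
      using False by simp
    also have "\<dots> \<le> \<bar>inverse c\<bar> * norm (c *\<^sub>R x)"
      by (rule le)
    finally have "\<bar>c\<bar> * norm x \<le> norm (c *\<^sub>R x)"
      using False by (simp add: field_simps)
    with le[of c x] show ?thesis by simp
  qed
qed (rule dist_james_def sgn_james_def uniformity_james_def open_james_def)+

end

lemma abs_james_nth_le_norm: "\<bar>james_nth x i\<bar> \<le> norm x"
  by (simp add: norm_james.rep_eq james_norm_coord james_nth_tendsto bdd_above_james_sums)

lemma james_l2_le_norm: "strict_mono_on {..n} p \<Longrightarrow> james_l2 (james_nth x) p n \<le> norm x"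
  by (simp add: norm_james.rep_eq james_norm_upper bdd_above_james_sums)

lemma tendsto_james_l2:
  assumes "\<And>i. ((\<lambda>k. X k i) \<longlongrightarrow> x i) F"
  shows "((\<lambda>k. james_l2 (X k) p n) \<longlongrightarrow> james_l2 x p n) F"
  unfolding james_l2_def L2_set_def by (intro tendsto_intros assms)

instance james :: banach
proof
  fix X :: "nat \<Rightarrow> james"
  assume X: "Cauchy X"
  have "Cauchy (\<lambda>k. james_nth (X k) i)" for i
  proof (rule metric_CauchyI)
    fix e :: real assume "0 < e"
    then obtain M where M: "\<forall>m\<ge>M. \<forall>n\<ge>M. dist (X m) (X n) < e"
      using metric_CauchyD[OF X] by blast
    have "dist (james_nth (X m) i) (james_nth (X n) i) \<le> dist (X m) (X n)" for m n
      using abs_james_nth_le_norm[of "X m - X n" i] by (simp add: dist_norm)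
    then show "\<exists>M. \<forall>m\<ge>M. \<forall>n\<ge>M. dist (james_nth (X m) i) (james_nth (X n) i) < e"
      using M by (meson le_less_trans)
  qed
  then have "\<exists>l. (\<lambda>k. james_nth (X k) i) \<longlonglongrightarrow> l" for i
    by (simp add: Cauchy_convergent_iff convergent_def)
  then obtain l where l: "\<And>i. (\<lambda>k. james_nth (X k) i) \<longlonglongrightarrow> l i"
    by metis
  have bound: "\<bar>james_nth (X m) i - l i\<bar> \<le> e"
      "strict_mono_on {..n} p \<Longrightarrow> james_l2 (\<lambda>i. james_nth (X m) i - l i) p n \<le> e"
    if M: "\<forall>m\<ge>M. \<forall>n\<ge>M. dist (X m) (X n) < e" and m: "m \<ge> M" for e M m i p n
  proof -
    have small: "norm (X m - X k) \<le> e" if "k \<ge> M" for k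
      using M m that by (auto simp: dist_norm intro: less_imp_le)
    have lim: "(\<lambda>k. james_nth (X m - X k) i) \<longlonglongrightarrow> james_nth (X m) i - l i" for i
      by (auto intro!: tendsto_intros l)
    show "\<bar>james_nth (X m) i - l i\<bar> \<le> e"
      using small abs_james_nth_le_norm order_trans
      by (intro LIMSEQ_le_const2[OF tendsto_rabs[OF lim]]) blast
    show "james_l2 (\<lambda>i. james_nth (X m) i - l i) p n \<le> e" if "strict_mono_on {..n} p"
      using small james_l2_le_norm[OF that] order_trans
      by (intro LIMSEQ_le_const2[OF tendsto_james_l2[OF lim]]) blast
  qed
  have "l \<longlonglongrightarrow> 0"
  proof (rule LIMSEQ_I)
    fix e :: real assume "0 < e"
    then have "0 < e / 2" by simp
    then obtain M where M: "\<forall>m\<ge>M. \<forall>n\<ge>M. dist (X m) (X n) < e / 2"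
      using metric_CauchyD[OF X] by blast
    obtain N where "\<forall>i\<ge>N. norm (james_nth (X M) i - 0) < e / 2"
      using LIMSEQ_D[OF james_nth_tendsto \<open>0 < e / 2\<close>] by blast
    then have "norm (l i - 0) < e" if "i \<ge> N" for i
      using bound(1)[OF M order_refl, of i] that \<open>0 < e / 2\<close>
      unfolding real_norm_def by (smt (verit) field_sum_of_halves)
    then show "\<exists>N. \<forall>i\<ge>N. norm (l i - 0) < e" by blast
  qed
  moreover have "bdd_above (james_sums l)"
  proof -
    obtain M where M: "\<forall>m\<ge>M. \<forall>n\<ge>M. dist (X m) (X n) < 1"
      using metric_CauchyD[OF X zero_less_one] by blast
    have "james_l2 l p n \<le> norm (X M) + 1" if p: "strict_mono_on {..n} p" for p n
    proof -
      have "james_l2 l p n \<le> james_l2 (james_nth (X M)) p n + james_l2 (\<lambda>i. (-1) * (james_nth (X M) i - l i)) p n"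
        using james_l2_add[of "james_nth (X M)" "\<lambda>i. (-1) * (james_nth (X M) i - l i)" p n] by simp
      also have "\<dots> \<le> norm (X M) + 1"
        using james_l2_le_norm[OF p, of "X M"] bound(2)[OF M order_refl p]
        by (simp only: james_l2_scale abs_minus_cancel abs_one mult_1 add_mono)
      finally show ?thesis .
    qed
    then show ?thesis by (rule bdd_james_sumsI)
  qed
  ultimately have nth: "james_nth (Abs_james l) = l"
    by (simp add: Abs_james_inverse)
  have "X \<longlonglongrightarrow> Abs_james l"
  proof (rule metric_LIMSEQ_I)
    fix e :: real assume "0 < e"
    then have "0 < e / 2" by simp
    then obtain M where M: "\<forall>m\<ge>M. \<forall>n\<ge>M. dist (X m) (X n) < e / 2"
      using metric_CauchyD[OF X] by blast
    have "dist (X m) (Abs_james l) \<le> e / 2" if "m \<ge> M" for m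
      unfolding dist_norm norm_james.rep_eq minus_james.rep_eq nth
      by (rule james_norm_least) (rule bound(2)[OF M that])
    then show "\<exists>M. \<forall>m\<ge>M. dist (X m) (Abs_james l) < e"
      using \<open>0 < e\<close> by (intro exI[of _ M]) fastforce
  qed
  then show "convergent X" by (rule convergentI)
qed

end

theory Submission
  imports Defs
begin

text \<open>
  For a weakly compact set \<open>D\<close> there are successive finite blocks \<open>I k\<close> of indices such that the
  averages of \<open>x\<close> over \<open>I k\<close> are at most \<open>d / 2 ^ k\<close> for all \<open>x\<close> in \<open>D\<close>. Let \<open>W x\<close> be the sequence of
  these averages and \<open>V = id - W\<close>. By convexity \<open>W\<close> does not increase the quadratic variation, so
  \<open>norm V \<le> 2\<close>, and \<open>x - V x = W x\<close> is small on \<open>D\<close>. The bidual consists of all sequences of bounded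
  quadratic variation; these converge, and \<open>W x\<close> has the same limit as \<open>x\<close>, so \<open>V\<close> maps the bidual
  into James' space and is therefore weakly compact. In concrete terms, the bidual ball is
  coordinatewise compact, and on bounded sets the weak topology is that of coordinatewise
  convergence because the unit vector basis is shrinking.
\<close>

section \<open>Quadratic variation\<close>

lemma james_l2_power2: "(james_l2 x p n)\<^sup>2 = (\<Sum>j<n. (x (p (Suc j)) - x (p j))\<^sup>2)"
  by (simp add: james_l2_def L2_set_def sum_nonneg)

lemma james_l2_comp: "james_l2 (\<lambda>j. x (p j)) id n = james_l2 x p n"
  by (simp add: james_l2_def)

lemma james_l2_cong: "(\<And>j. j \<le> n \<Longrightarrow> x (p j) = y (p j)) \<Longrightarrow> james_l2 x p n = james_l2 y p n"
  by (auto simp: james_l2_def intro!: L2_set_cong)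

lemma james_l2_sum: "finite I \<Longrightarrow> james_l2 (\<lambda>j. \<Sum>i\<in>I. z i j) p n \<le> (\<Sum>i\<in>I. james_l2 (z i) p n)"
proof (induction I rule: finite_induct)
  case empty
  then show ?case by (simp add: james_l2_def L2_set_def)
next
  case (insert a I)
  then show ?case
    using order_trans[OF james_l2_add add_left_mono[OF insert.IH]] by simp
qed

lemma james_norm_least_power2:
  assumes "\<And>p n. strict_mono_on {..n} p \<Longrightarrow> (\<Sum>j<n. (x (p (Suc j)) - x (p j))\<^sup>2) \<le> B"
  shows "(james_norm x)\<^sup>2 \<le> B"
proof -
  have B: "0 \<le> B"
    using assms[OF strict_mono_on_Suc, of 0] by simp
  have "james_norm x \<le> sqrt B"
    by (rule james_norm_least, rule real_le_rsqrt) (simp add: james_l2_power2 assms)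
  moreover have "0 \<le> james_norm x"
    by (intro james_norm_nonneg bdd_james_sumsI[of _ "sqrt B"] real_le_rsqrt)
      (simp add: james_l2_power2 assms)
  ultimately show ?thesis
    using B power_mono[of "james_norm x" "sqrt B" 2] by simp
qed

lemma strict_mono_on_atMost_shift:
  fixes p :: "nat \<Rightarrow> nat"
  assumes "strict_mono_on {..n} p" "d \<le> n"
  shows "strict_mono_on {..n - d} (\<lambda>j. p (j + d))"
  using assms by (intro strict_mono_onI) (auto intro!: strict_mono_onD[OF assms(1)])

text \<open>Prolonging a path that nearly attains the supremum shows that little variation is left.\<close>
lemma james_l2_tail_small:
  assumes bdd: "bdd_above (james_sums x)" and "0 < e"
  obtains q where "\<And>p n. strict_mono_on {..n} p \<Longrightarrow> q \<le> p 0 \<Longrightarrow> james_l2 x p n \<le> e"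
proof -
  let ?S = "Sup (james_sums x)"
  have "?S - e\<^sup>2 < ?S"
    using \<open>0 < e\<close> by simp
  then obtain s where s: "s \<in> james_sums x" "?S - e\<^sup>2 < s"
    using less_cSupD[OF james_sums_nonempty] by metis
  then obtain p0 n0 where p0: "strict_mono_on {..n0} p0" "s = (james_l2 x p0 n0)\<^sup>2"
    by (auto simp: james_sums_l2)
  have "james_l2 x p n \<le> e" if p: "strict_mono_on {..n} p" "Suc (p0 n0) \<le> p 0" for p n
  proof -
    \<comment> \<open>\<open>r\<close> runs through \<open>p0\<close> and then through
      \<open>p\<close>. The increment of index \<open>n0\<close>, which joins the two, is dropped in
      the estimate.\<close>
    define r where "r j = (if j \<le> n0 then p0 j else p (j - Suc n0))" for j
    have p0_le: "p0 j \<le> p0 n0" if "j \<le> n0" for j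
      using p0(1) that by (metis atMost_iff order_refl strict_mono_on_leD)
    have p_ge: "p 0 \<le> p j" if "j \<le> n" for j
      using p(1) that by (metis atMost_iff le0 strict_mono_on_leD)
    have r: "strict_mono_on {..Suc n0 + n} r"
    proof (rule strict_mono_onI)
      fix i j assume ij: "i \<in> {..Suc n0 + n}" "j \<in> {..Suc n0 + n}" "i < j"
      consider "j \<le> n0" | "i \<le> n0" "n0 < j" | "n0 < i" by linarith
      then show "r i < r j"
      proof cases
        case 1
        then show ?thesis using ij p0(1) by (auto simp: r_def strict_mono_on_def)
      next
        case 2
        then show ?thesis
          using ij p0_le[of i] p_ge[of "j - Suc n0"] p(2) le_diff_conv[of j "Suc n0" n]
          by (simp add: r_def add.commute)
      next
        case 3
        then show ?thesis
          using ij by (auto simp: r_def intro!: strict_mono_onD[OF p(1)] diff_less_mono)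
      qed
    qed
    let ?g = "\<lambda>j. (x (r (Suc j)) - x (r j))\<^sup>2"
    have "(james_l2 x p0 n0)\<^sup>2 + (james_l2 x p n)\<^sup>2 = (\<Sum>j<n0. ?g j) + (\<Sum>j<n. ?g (j + Suc n0))"
      unfolding james_l2_power2 by (intro arg_cong2[of _ _ _ _ "(+)"] sum.cong) (auto simp: r_def)
    also have "(\<Sum>j<n. ?g (j + Suc n0)) = (\<Sum>j\<in>{Suc n0..<Suc n0 + n}. ?g j)"
      using sum.shift_bounds_nat_ivl[of ?g 0 "Suc n0" n] by (simp add: atLeast0LessThan add.commute)
    also have "(\<Sum>j<n0. ?g j) + \<dots> = (\<Sum>j\<in>{..<n0} \<union> {Suc n0..<Suc n0 + n}. ?g j)"
      by (rule sum.union_disjoint[symmetric]) auto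
    also have "\<dots> \<le> (\<Sum>j<Suc n0 + n. ?g j)"
      by (rule sum_mono2) auto
    also have "\<dots> = (james_l2 x r (Suc n0 + n))\<^sup>2"
      by (simp add: james_l2_power2)
    also have "\<dots> \<le> ?S"
      using r by (intro cSup_upper bdd) (auto simp: james_sums_l2)
    finally have "(james_l2 x p n)\<^sup>2 \<le> e\<^sup>2"
      using s p0(2) by simp
    then show ?thesis
      using \<open>0 < e\<close> power2_le_imp_le by fastforce
  qed
  then show ?thesis
    using that by blast
qed

lemma strict_mono_on_pair: "i < k \<Longrightarrow> strict_mono_on {..Suc 0} (\<lambda>j. if j = 0 then i else k)"
  for i k :: nat
  by (auto simp: strict_mono_on_def)

lemma james_l2_pair: "james_l2 x (\<lambda>j. if j = 0 then i else k) (Suc 0) = \<bar>x k - x i\<bar>"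
  by (simp add: james_l2_def L2_set_def)

text \<open>Two-point paths beyond the index given by \<open>james_l2_tail_small\<close> show that
  the sequence is Cauchy. Its limit may differ from 0; this is what separates the bidual from James'
  space.\<close>

lemma bdd_james_sums_imp_convergent:
  assumes "bdd_above (james_sums x)"
  shows "convergent x"
proof -
  have "Cauchy x"
  proof (rule CauchyI')
    fix e :: real assume "0 < e"
    then have "0 < e / 2" by simp
    from james_l2_tail_small[OF assms this] obtain q where
      q: "\<And>p n. strict_mono_on {..n} p \<Longrightarrow> q \<le> p 0 \<Longrightarrow> james_l2 x p n \<le> e / 2" by blast
    have "dist (x m) (x n) < e" if "q \<le> m" "m < n" for m n
      using q[OF strict_mono_on_pair[OF that(2)]] that(1) \<open>0 < e\<close> 
      by (simp add: james_l2_pair dist_real_def abs_minus_commute)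
    then show "\<exists>M. \<forall>m\<ge>M. \<forall>n>m. dist (x m) (x n) < e" by blast
  qed
  then show ?thesis
    by (simp add: Cauchy_convergent_iff)
qed

section \<open>The unit vector basis is shrinking\<close>

text \<open>The argument is an arbitrary sequence, so that unit vectors arise as truncations as
  well.\<close>

lift_definition james_trunc :: "nat \<Rightarrow> (nat \<Rightarrow> real) \<Rightarrow> james"
  is "\<lambda>q x i. if i < q then x i else 0"
proof
  fix q and x :: "nat \<Rightarrow> real"
  show "(\<lambda>i. if i < q then x i else 0) \<longlonglongrightarrow> 0"
    by (rule tendsto_eventually, rule eventually_sequentiallyI[of q]) simp
  \<comment> \<open>A path meets each index below \<open>q\<close> at most once as the left and once
    as the right end of an increment.\<close>
  have "james_l2 (\<lambda>i. if i < q then x i else 0) p n \<le> (\<Sum>i<q. 2 * \<bar>x i\<bar>)"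
    if p: "strict_mono_on {..n} p" for p n
  proof -
    let ?z = "\<lambda>i. if i < q then \<bar>x i\<bar> else 0"
    have inj: "inj_on p {..<n}" "inj_on (\<lambda>j. p (Suc j)) {..<n}"
      using p by (auto intro!: inj_onI dest: strict_mono_on_eqD)
    have le: "(\<Sum>j<n. ?z (f j)) \<le> (\<Sum>i<q. \<bar>x i\<bar>)" if f: "inj_on f {..<n}" for f
    proof -
      have "(\<Sum>j<n. ?z (f j)) = sum ?z (f ` {..<n})"
        by (simp add: sum.reindex[OF f] o_def)
      also have "\<dots> = sum ?z (f ` {..<n} \<inter> {..<q})"
        by (rule sum.mono_neutral_right) auto
      also have "\<dots> \<le> sum ?z {..<q}"
        by (rule sum_mono2) auto
      finally show ?thesis by simp
    qed
    have "james_l2 (\<lambda>i. if i < q then x i else 0) p n \<le> (\<Sum>j<n. ?z (p (Suc j)) + ?z (p j))"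
      unfolding james_l2_def by (rule order_trans[OF L2_set_le_sum_abs], rule sum_mono) auto
    also have "\<dots> \<le> (\<Sum>i<q. \<bar>x i\<bar>) + (\<Sum>i<q. \<bar>x i\<bar>)"
      unfolding sum.distrib by (intro add_mono le inj)
    finally show ?thesis by (simp add: sum_distrib_left[symmetric])
  qed
  then show "bdd_above (james_sums (\<lambda>i. if i < q then x i else 0))"
    by (rule bdd_james_sumsI)
qed

text \<open>An increasing path passes the threshold \<open>q\<close> at most once. This bounds the
  one exceptional increment whenever sequences are cut at \<open>q\<close>.\<close>

lemma sum_crossing_le:
  fixes p :: "nat \<Rightarrow> nat" and K :: real
  assumes p: "strict_mono_on {..n} p" and "0 \<le> K"
  shows "(\<Sum>j<n. if p j < q \<and> q \<le> p (Suc j) then K else 0) \<le> K"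
proof -
  let ?C = "{j \<in> {..<n}. p j < q \<and> q \<le> p (Suc j)}"
  have "i = j" if "i \<in> ?C" "j \<in> ?C" for i j
  proof (rule ccontr)
    have mono: "p (Suc i) \<le> p j" if "i < j" "j < n" for i j
      using p that by (intro strict_mono_on_leD[OF p]) auto
    assume "i \<noteq> j"
    then consider "i < j" | "j < i" by linarith
    then show False
      using mono[of i j] mono[of j i] that by cases auto
  qed
  then have "card ?C \<le> Suc 0"
    by (subst card_le_Suc0_iff_eq) auto
  then have "real (card ?C) * K \<le> 1 * K"
    using \<open>0 \<le> K\<close> by (intro mult_right_mono) auto
  moreover have "(\<Sum>j<n. if p j < q \<and> q \<le> p (Suc j) then K else 0) = real (card ?C) * K"
    by (subst sum.inter_filter[symmetric]) auto
  ultimately show ?thesis by simp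
qed

lemma james_norm_power2_le:
  assumes "\<And>p n. strict_mono_on {..n} p \<Longrightarrow>
    (\<Sum>j<n. (james_nth x (p (Suc j)) - james_nth x (p j))\<^sup>2) \<le> B"
  shows "(norm x)\<^sup>2 \<le> B"
  unfolding norm_james.rep_eq by (rule james_norm_least_power2) (rule assms)

text \<open>Beyond a large \<open>q\<close> both the remaining variation and the coordinates of
  \<open>x\<close> are small. The former controls the increments starting at \<open>q\<close> or
  later, the latter the single increment crossing \<open>q\<close>.\<close>

lemma ex_james_trunc_close:
  assumes "0 < e"
  shows "\<exists>q. norm (x - james_trunc q (james_nth x)) < e"
proof -
  define c where "c = e / 2"
  have c: "0 < c" using assms by (simp add: c_def)
  obtain q1 where q1: "\<And>p n. strict_mono_on {..n} p \<Longrightarrow> q1 \<le> p 0 \<Longrightarrow> james_l2 (james_nth x) p n \<le> c"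
    using james_l2_tail_small[OF bdd_above_james_sums c] by blast
  obtain q2 where q2: "\<And>i. q2 \<le> i \<Longrightarrow> \<bar>james_nth x i\<bar> < c"
    using LIMSEQ_D[OF james_nth_tendsto c, of x] by auto
  define q where "q = max q1 q2"
  let ?z = "x - james_trunc q (james_nth x)"
  have z: "james_nth ?z i = (if i < q then 0 else james_nth x i)" for i
    by (simp add: james_trunc.rep_eq)
  have "(norm ?z)\<^sup>2 \<le> c\<^sup>2 + c\<^sup>2"
  proof (rule james_norm_power2_le)
    fix p n assume p: "strict_mono_on {..n} (p :: nat \<Rightarrow> nat)"
    let ?dz = "\<lambda>j. (james_nth ?z (p (Suc j)) - james_nth ?z (p j))\<^sup>2"
    let ?dx = "\<lambda>j. (james_nth x (p (Suc j)) - james_nth x (p j))\<^sup>2"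
    have mono: "p i \<le> p j" if "i \<le> j" "j \<le> n" for i j
      using that by (intro strict_mono_on_leD[OF p]) auto
    have tail: "(\<Sum>j<n. if q \<le> p j then ?dx j else 0) \<le> c\<^sup>2"
    proof (cases "q \<le> p n")
      case False
      then have "\<not> q \<le> p j" if "j < n" for j
        using mono[of j n] that by simp
      then show ?thesis by simp
    next
      case True
      \<comment> \<open>From the first place \<open>m\<close> where the path reaches
        \<open>q\<close>, the increments are those of a shifted path.\<close>
      define m where "m = (LEAST j. q \<le> p j)"
      have m: "q \<le> p m" "m \<le> n"
        using LeastI[of "\<lambda>j. q \<le> p j", OF True] Least_le[of "\<lambda>j. q \<le> p j", OF True]
        by (simp_all add: m_def)
      have iff: "q \<le> p j \<longleftrightarrow> m \<le> j" if "j < n" for j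
        using Least_le[of "\<lambda>j. q \<le> p j" j] mono[of m j] m that by (auto simp: m_def)
      have "(\<Sum>j<n. if q \<le> p j then ?dx j else 0) = (\<Sum>j\<in>{m..<n}. ?dx j)"
        by (rule sum.mono_neutral_cong_right) (auto simp: iff)
      also have "\<dots> = (\<Sum>j<n - m. ?dx (j + m))"
        using sum.shift_bounds_nat_ivl[of ?dx 0 m "n - m"] m by (simp add: atLeast0LessThan)
      also have "\<dots> = (james_l2 (james_nth x) (\<lambda>j. p (j + m)) (n - m))\<^sup>2"
        by (simp add: james_l2_power2)
      also have "\<dots> \<le> c\<^sup>2"
        using m(1) by (intro power_mono q1 strict_mono_on_atMost_shift p m(2)) (auto simp: q_def)
      finally show ?thesis .
    qed
    have pt: "?dz j \<le> (if q \<le> p j then ?dx j else 0) + (if p j < q \<and> q \<le> p (Suc j) then c\<^sup>2 else 0)"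
      if "j < n" for j
    proof -
      have "(james_nth x i)\<^sup>2 \<le> c\<^sup>2" if "q \<le> i" for i
        using q2[of i] that by (simp add: q_def abs_le_square_iff[symmetric])
      then show ?thesis
        using mono[of j "Suc j"] that by (auto simp: james_trunc.rep_eq)
    qed
    have "(\<Sum>j<n. ?dz j) \<le> (\<Sum>j<n. (if q \<le> p j then ?dx j else 0)
        + (if p j < q \<and> q \<le> p (Suc j) then c\<^sup>2 else 0))"
      by (rule sum_mono) (simp only: pt lessThan_iff)
    also have "\<dots> \<le> c\<^sup>2 + c\<^sup>2"
      unfolding sum.distrib by (intro add_mono tail sum_crossing_le p) simp
    finally show "(\<Sum>j<n. ?dz j) \<le> c\<^sup>2 + c\<^sup>2" .
  qed
  also have "\<dots> < e\<^sup>2"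
    using assms by (simp add: c_def power2_eq_square field_simps)
  finally have "norm ?z < e"
    using assms power2_less_imp_less by fastforce
  then show ?thesis ..
qed

text \<open>An increment not crossing \<open>q\<close> sees only one of \<open>u\<close> and
  \<open>v\<close>; the crossing one is a value of \<open>v\<close> minus a value of
  \<open>u\<close>. The extra term thus involves only coordinate bounds, which do not grow when
  further blocks are added.\<close>

lemma norm_james_disjoint_le:
  assumes u: "\<And>i. q \<le> i \<Longrightarrow> james_nth u i = 0" "\<And>i. \<bar>james_nth u i\<bar> \<le> a"
    and v: "\<And>i. i < q \<Longrightarrow> james_nth v i = 0" "\<And>i. \<bar>james_nth v i\<bar> \<le> b"
  shows "(norm (u + v))\<^sup>2 \<le> (norm u)\<^sup>2 + (norm v)\<^sup>2 + (a + b)\<^sup>2"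
proof (rule james_norm_power2_le)
  fix p n assume p: "strict_mono_on {..n} (p :: nat \<Rightarrow> nat)"
  let ?d = "\<lambda>x j. (james_nth x (p (Suc j)) - james_nth x (p j))\<^sup>2"
  have pt: "?d (u + v) j \<le> ?d u j + ?d v j
      + (if p j < q \<and> q \<le> p (Suc j) then (a + b)\<^sup>2 else 0)" if "j < n" for j
  proof -
    have less: "p j < p (Suc j)"
      using p that by (auto simp: strict_mono_on_def)
    consider "p (Suc j) < q" | "q \<le> p j" | "p j < q" "q \<le> p (Suc j)" by linarith
    then show ?thesis
    proof cases
      case 1
      then show ?thesis using less by (simp add: v)
    next
      case 2
      then show ?thesis using less by (simp add: u)
    next
      case 3
      have "\<bar>james_nth v (p (Suc j)) - james_nth u (p j)\<bar> \<le> \<bar>a + b\<bar>"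
        using u(2)[of "p j"] v(2)[of "p (Suc j)"] by linarith
      then have "(james_nth v (p (Suc j)) - james_nth u (p j))\<^sup>2 \<le> (a + b)\<^sup>2"
        by (simp only: abs_le_square_iff)
      then show ?thesis
        using 3 by (simp add: u v add_increasing)
    qed
  qed
  have le: "(\<Sum>j<n. ?d x j) \<le> (norm x)\<^sup>2" for x
    using james_l2_le_norm[OF p, of x] by (simp add: power_mono flip: james_l2_power2)
  have "(\<Sum>j<n. ?d (u + v) j) \<le> (\<Sum>j<n. ?d u j + ?d v j
      + (if p j < q \<and> q \<le> p (Suc j) then (a + b)\<^sup>2 else 0))"
    by (rule sum_mono) (simp only: pt lessThan_iff)
  also have "\<dots> \<le> (norm u)\<^sup>2 + (norm v)\<^sup>2 + (a + b)\<^sup>2"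
    unfolding sum.distrib by (intro add_mono le sum_crossing_le p) simp
  finally show "(\<Sum>j<n. ?d (u + v) j) \<le> (norm u)\<^sup>2 + (norm v)\<^sup>2 + (a + b)\<^sup>2" .
qed

text \<open>
  Otherwise there are successive normalised blocks on which \<open>f\<close> exceeds \<open>e\<close>; the sum of \<open>k\<close> of
  them has norm at most \<open>sqrt (5 * k)\<close>, but \<open>f\<close> is at least \<open>k * e\<close> there.
\<close>
lemma james_shrinking:
  fixes f :: "james \<Rightarrow>\<^sub>L real"
  assumes "0 < e"
  shows "\<exists>q. \<forall>v. (\<forall>i<q. james_nth v i = 0) \<longrightarrow> \<bar>f v\<bar> \<le> e * norm v"
proof (rule ccontr)
  assume "\<not> ?thesis"
  then have H: "\<exists>v. (\<forall>i<q. james_nth v i = 0) \<and> e * norm v < \<bar>f v\<bar>" for q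
    by (simp add: not_le)
  have step: "\<exists>v r. q \<le> r \<and> (\<forall>i<q. james_nth v i = 0) \<and> (\<forall>i\<ge>r. james_nth v i = 0)
      \<and> norm v = 1 \<and> e \<le> f v" for q
  proof -
    obtain v where v: "\<And>i. i < q \<Longrightarrow> james_nth v i = 0" "e * norm v < \<bar>f v\<bar>"
      using H by blast
    have pos: "0 < norm f + e"
      using assms by (simp add: add_nonneg_pos)
    \<comment> \<open>The tolerance is such that the strict inequality for \<open>v\<close> survives
      in the truncation \<open>w\<close>.\<close>
    then obtain r where r: "norm (v - james_trunc r (james_nth v)) < (\<bar>f v\<bar> - e * norm v) / (norm f + e)"
      using ex_james_trunc_close[of "(\<bar>f v\<bar> - e * norm v) / (norm f + e)" v] v(2) by auto
    define w where "w = james_trunc r (james_nth v)"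
    have gap: "norm f * norm (v - w) + e * norm (v - w) < \<bar>f v\<bar> - e * norm v"
      using r pos by (simp add: w_def pos_less_divide_eq algebra_simps)
    have "\<bar>f v\<bar> - \<bar>f w\<bar> \<le> norm f * norm (v - w)"
      using norm_blinfun[of f "v - w"] by (simp add: blinfun.diff_right)
    moreover have "e * norm w \<le> e * norm v + e * norm (v - w)"
      using mult_left_mono[OF norm_triangle_ineq4[of v "v - w"], of e] assms by (simp add: algebra_simps)
    ultimately have fw: "e * norm w < \<bar>f w\<bar>"
      using gap by linarith
    then have "w \<noteq> 0" by auto
    define v' where "v' = (sgn (f w) / norm w) *\<^sub>R w"
    have "norm v' = 1" 
      using fw \<open>w \<noteq> 0\<close> assms by (auto simp: v'_def sgn_if mult_less_0_iff)
    moreover have "e \<le> f v'"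
      using fw \<open>w \<noteq> 0\<close> by (simp add: v'_def blinfun.scaleR_right field_simps abs_sgn)
    moreover have "\<forall>i<q. james_nth v' i = 0" "\<forall>i\<ge>max q r. james_nth v' i = 0"
      using v(1) by (simp_all add: v'_def w_def james_trunc.rep_eq)
    ultimately show ?thesis
      by (intro exI[of _ v'] exI[of _ "max q r"]) auto
  qed
  \<comment> \<open>The coordinate bound 1 is carried along, so that each new block adds at most
    \<open>1 + (1 + 1)^2 = 5\<close> to the squared norm.\<close>
  have sums: "\<exists>s q. (\<forall>i\<ge>q. james_nth s i = 0) \<and> (\<forall>i. \<bar>james_nth s i\<bar> \<le> 1)
      \<and> (norm s)\<^sup>2 \<le> 5 * real k \<and> real k * e \<le> f s" for k
  proof (induction k)
    case 0
    show ?case by (intro exI[of _ 0]) simp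
  next
    case (Suc k)
    then obtain s q where s: "\<And>i. q \<le> i \<Longrightarrow> james_nth s i = 0" "\<And>i. \<bar>james_nth s i\<bar> \<le> 1"
      "(norm s)\<^sup>2 \<le> 5 * real k" "real k * e \<le> f s" by blast
    obtain v r where v: "q \<le> r" "\<And>i. i < q \<Longrightarrow> james_nth v i = 0" "\<And>i. r \<le> i \<Longrightarrow> james_nth v i = 0"
      "norm v = 1" "e \<le> f v"
      using step[of q] by blast
    have v1: "\<bar>james_nth v i\<bar> \<le> 1" for i
      using abs_james_nth_le_norm[of v i] v(4) by simp
    have "(norm (s + v))\<^sup>2 \<le> (norm s)\<^sup>2 + (norm v)\<^sup>2 + (1 + 1)\<^sup>2"
      by (rule norm_james_disjoint_le[OF s(1,2) v(2) v1])
    then have "(norm (s + v))\<^sup>2 \<le> 5 * real (Suc k)"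
      using s(3) v(4) by simp
    moreover have "real (Suc k) * e \<le> f (s + v)"
      using s(4) v(5) by (simp add: blinfun.add_right algebra_simps)
    moreover have "\<bar>james_nth (s + v) i\<bar> \<le> 1" for i
      using s(1,2)[of i] v(2)[of i] v1[of i] by (cases "i < q") auto
    moreover have "james_nth (s + v) i = 0" if "r \<le> i" for i
      using s(1)[of i] v(1,3) that by simp
    ultimately show ?case by blast
  qed
  have "real k * e\<^sup>2 \<le> 5 * (norm f)\<^sup>2" for k
  proof (cases "k = 0")
    case False
    obtain s where s: "(norm s)\<^sup>2 \<le> 5 * real k" "real k * e \<le> f s"
      using sums[of k] by blast
    have "real k * e \<le> norm f * norm s"
      using s(2) norm_blinfun[of f s] by simp
    then have "(real k * e)\<^sup>2 \<le> (norm f * norm s)\<^sup>2"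
      using assms by (intro power_mono) auto
    also have "\<dots> \<le> (norm f)\<^sup>2 * (5 * real k)"
      using s(1) by (simp add: power_mult_distrib mult_left_mono)
    finally have "real k * (real k * e\<^sup>2) \<le> real k * (5 * (norm f)\<^sup>2)"
      by (simp add: power2_eq_square algebra_simps)
    then show ?thesis
      using False by simp
  qed simp
  moreover obtain k where "5 * (norm f)\<^sup>2 < real k * e\<^sup>2"
    using reals_Archimedean3[of "e\<^sup>2"] assms by auto
  ultimately show False
    by (meson not_le)
qed

text \<open>Increments starting at \<open>q\<close> or later are those of \<open>x\<close>, and the
  crossing one is a coordinate of \<open>x\<close>, hence at most its norm. The factor 2 is a coarse
  bound for \<open>sqrt 2\<close>.\<close>

lemma norm_james_tail_le: "norm (x - james_trunc q (james_nth x)) \<le> 2 * norm x"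
proof -
  let ?z = "x - james_trunc q (james_nth x)"
  have "(norm ?z)\<^sup>2 \<le> (norm x)\<^sup>2 + (norm x)\<^sup>2"
  proof (rule james_norm_power2_le)
    fix p n assume p: "strict_mono_on {..n} (p :: nat \<Rightarrow> nat)"
    let ?d = "\<lambda>x j. (james_nth x (p (Suc j)) - james_nth x (p j))\<^sup>2"
    have pt: "?d ?z j \<le> ?d x j + (if p j < q \<and> q \<le> p (Suc j) then (norm x)\<^sup>2 else 0)"
      if "j < n" for j
    proof -
      have "p j < p (Suc j)"
        using p that by (auto simp: strict_mono_on_def)
      moreover have "(james_nth x i)\<^sup>2 \<le> (norm x)\<^sup>2" for i
        using power_mono[OF abs_james_nth_le_norm[of x i], of 2] by simp
      ultimately show ?thesis
        by (auto simp: james_trunc.rep_eq add_increasing)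
    qed
    have "(\<Sum>j<n. ?d ?z j)
        \<le> (\<Sum>j<n. ?d x j + (if p j < q \<and> q \<le> p (Suc j) then (norm x)\<^sup>2 else 0))"
      by (rule sum_mono) (simp only: pt lessThan_iff)
    also have "\<dots> \<le> (norm x)\<^sup>2 + (norm x)\<^sup>2"
      unfolding sum.distrib james_l2_power2[symmetric]
      by (intro add_mono power_mono james_l2_le_norm sum_crossing_le p) auto
    finally show "(\<Sum>j<n. ?d ?z j) \<le> (norm x)\<^sup>2 + (norm x)\<^sup>2" .
  qed
  also have "\<dots> \<le> (2 * norm x)\<^sup>2"
    by simp
  finally show ?thesis
    by (rule power2_le_imp_le) simp
qed

section \<open>Weak compactness in James' space\<close>

lemma openin_weak_vimage:
  fixes f :: "'a::real_normed_vector \<Rightarrow>\<^sub>L real"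
  shows "open U \<Longrightarrow> openin weak_topology (blinfun_apply f -` U)"
  unfolding weak_topology_def
  by (rule topology_generated_by_Basis) blast

lemma topspace_weak_topology [simp]: "topspace weak_topology = UNIV"
  using openin_subset[OF openin_weak_vimage[of UNIV 0]] by auto

lift_definition james_coord :: "nat \<Rightarrow> james \<Rightarrow>\<^sub>L real" is "\<lambda>i x. james_nth x i"
  by (rule bounded_linear_intro[of _ 1]) (auto simp: abs_james_nth_le_norm)

text \<open>The coordinate functionals separate points. As a consequence, weakly compact sets are
  weakly closed.\<close>

lemma Hausdorff_weak_topology_james: "Hausdorff_space (weak_topology :: james topology)"
  unfolding Hausdorff_space_def
proof (intro allI impI)
  fix x y :: james
  assume "x \<in> topspace weak_topology \<and> y \<in> topspace weak_topology \<and> x \<noteq> y"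
  then obtain i where "james_coord i x \<noteq> james_coord i y"
    using james_eqI by (auto simp: james_coord.rep_eq)
  then obtain U V where UV: "open U" "open V" "james_coord i x \<in> U" "james_coord i y \<in> V" "U \<inter> V = {}"
    using hausdorff by metis
  then show "\<exists>U V. openin weak_topology U \<and> openin weak_topology V \<and> x \<in> U \<and> y \<in> V \<and> disjnt U V"
    by (intro exI[of _ "james_coord i -` U"] exI[of _ "james_coord i -` V"])
      (auto simp: openin_weak_vimage disjnt_def)
qed

text \<open>For fixed \<open>q\<close> this is a finite linear combination of the coordinates
  \<open>h x i\<close>; the induction splits off the multiple of the last unit vector.\<close>

lemma continuous_on_blinfun_james_trunc:
  fixes f :: "james \<Rightarrow>\<^sub>L real"
  assumes "\<And>i. continuous_on K (\<lambda>x. h x i)"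
  shows "continuous_on K (\<lambda>x. f (james_trunc q (h x)))"
proof (induction q)
  case 0
  have "james_trunc 0 y = 0" for y
    by (rule james_eqI) (simp add: james_trunc.rep_eq)
  then show ?case by simp
next
  case (Suc q)
  have "james_trunc (Suc q) y
      = james_trunc q y + y q *\<^sub>R james_trunc (Suc q) (\<lambda>i. if i = q then 1 else 0)" for y
    by (rule james_eqI) (auto simp: james_trunc.rep_eq less_Suc_eq)
  then have *: "f (james_trunc (Suc q) (h x)) = f (james_trunc q (h x))
      + h x q * f (james_trunc (Suc q) (\<lambda>i. if i = q then 1 else 0))" for x
    by (metis blinfun.add_right blinfun.scaleR_right real_scaleR_def)
  show ?case
    unfolding * by (intro continuous_intros Suc.IH assms)
qed

text \<open>
  The basis being shrinking, \<open>f\<close> is on bounded sets a uniform limit of functions of finitely many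
  coordinates.
\<close>
lemma continuous_on_blinfun_james:
  fixes f :: "james \<Rightarrow>\<^sub>L real" and g :: "'a::topological_space \<Rightarrow> james"
  assumes cont: "\<And>i. continuous_on K (\<lambda>x. james_nth (g x) i)"
    and bound: "\<And>x. x \<in> K \<Longrightarrow> norm (g x) \<le> B"
  shows "continuous_on K (\<lambda>x. f (g x))"
proof (rule uniform_limit_theorem)
  show "\<forall>\<^sub>F q in sequentially. continuous_on K (\<lambda>x. f (james_trunc q (james_nth (g x))))"
    by (intro always_eventually allI continuous_on_blinfun_james_trunc cont)
  show "uniform_limit K (\<lambda>q x. f (james_trunc q (james_nth (g x)))) (\<lambda>x. f (g x)) sequentially"
  proof (rule uniform_limitI)
    fix e :: real assume "0 < e"
    \<comment> \<open>The factor 2 comes from \<open>norm_james_tail_le\<close>; adding 1 keeps the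
      denominator positive.\<close>
    define c where "c = e / (2 * \<bar>B\<bar> + 1)"
    have "0 < c" and c: "c * (2 * \<bar>B\<bar>) < e"
      using \<open>0 < e\<close> by (simp_all add: c_def field_simps)
    then obtain q0 where q0: "\<And>v. (\<forall>i<q0. james_nth v i = 0) \<Longrightarrow> \<bar>f v\<bar> \<le> c * norm v"
      using james_shrinking[of c f] by blast
    have "dist (f (james_trunc q (james_nth (g x)))) (f (g x)) < e" if "q0 \<le> q" "x \<in> K" for q x
    proof -
      let ?v = "g x - james_trunc q (james_nth (g x))"
      have "\<bar>f ?v\<bar> \<le> c * norm ?v"
        using that(1) by (intro q0) (simp add: james_trunc.rep_eq)
      also have "\<dots> \<le> c * (2 * \<bar>B\<bar>)"
        using norm_james_tail_le[of "g x" q] bound[OF that(2)] \<open>0 < c\<close> by (intro mult_left_mono) auto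
      also note c
      finally show ?thesis
        by (simp add: dist_real_def blinfun.diff_right abs_minus_commute)
    qed
    then show "\<forall>\<^sub>F q in sequentially. \<forall>x\<in>K. dist (f (james_trunc q (james_nth (g x)))) (f (g x)) < e"
      by (intro eventually_sequentiallyI[of q0]) blast
  qed
qed simp

text \<open>By the preceding lemma \<open>g\<close> is continuous into the weak topology, which is
  generated by preimages under functionals. The later use is with \<open>minus_avg\<close> on a
  coordinatewise compact set.\<close>

lemma weakly_compact_james_image:
  fixes g :: "'a::topological_space \<Rightarrow> james"
  assumes "compact K" "\<And>i. continuous_on K (\<lambda>x. james_nth (g x) i)"
    and "\<And>x. x \<in> K \<Longrightarrow> norm (g x) \<le> B"
  shows "weakly_compact (g ` K)"
  unfolding weakly_compact_def
proof (rule image_compactin)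
  show "compactin (top_of_set K) K"
    using \<open>compact K\<close> by (simp add: compactin_subtopology)
  show "continuous_map (top_of_set K) weak_topology g"
    unfolding weak_topology_def
  proof (rule continuous_on_generated_topo)
    fix W :: "james set"
    assume "W \<in> {blinfun_apply f -` U |(f :: james \<Rightarrow>\<^sub>L real) U. open U}"
    then obtain f :: "james \<Rightarrow>\<^sub>L real" and U where W: "W = blinfun_apply f -` U" "open U"
      by blast
    have "continuous_on K (\<lambda>x. f (g x))"
      by (rule continuous_on_blinfun_james[OF assms(2,3)])
    from continuous_openin_preimage_gen[OF this W(2)]
    show "openin (top_of_set K) (g -` W \<inter> topspace (top_of_set K))"
      by (simp add: W vimage_def Int_def conj_commute)
  next
    show "g ` topspace (top_of_set K) \<subseteq> \<Union> {blinfun_apply f -` U |(f :: james \<Rightarrow>\<^sub>L real) U. open U}"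
      by (metis (mono_tags, lifting) UNIV_I UnionI mem_Collect_eq open_UNIV subsetI vimage_UNIV)
  qed
qed

text \<open>Weak compactness of an operator concerns the closure of the image of the ball; this
  reduces it to finding a weakly compact superset of the image.\<close>

lemma weakly_compact_closure_james:
  fixes A :: "james set"
  assumes "weakly_compact S" "A \<subseteq> S"
  shows "weakly_compact (weak_topology closure_of A)"
proof -
  have "closedin weak_topology S"
    using assms(1) by (intro compactin_imp_closedin Hausdorff_weak_topology_james)
      (simp add: weakly_compact_def)
  then have "weak_topology closure_of A \<subseteq> S"
    using assms(2) by (intro closure_of_minimal)
  then show ?thesis
    unfolding weakly_compact_def
    by (rule closed_compactin[OF assms(1)[unfolded weakly_compact_def]]) simp
qed

text \<open>The uniform boundedness principle, for points regarded as functionals on the dual space.\<close>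
lemma pointwise_bounded_imp_bounded:
  fixes D :: "'a::real_normed_vector set"
  assumes "\<And>f :: 'a \<Rightarrow>\<^sub>L real. bounded (blinfun_apply f ` D)"
  obtains C where "0 \<le> C" "\<And>(f :: 'a \<Rightarrow>\<^sub>L real) x. x \<in> D \<Longrightarrow> \<bar>blinfun_apply f x\<bar> \<le> C * norm f"
proof -
  \<comment> \<open>The closed sets \<open>F n\<close> cover the dual space, which is complete, so
    by Baire one of them contains a ball.\<close>
  define F where "F n = {f :: 'a \<Rightarrow>\<^sub>L real. \<forall>x\<in>D. \<bar>blinfun_apply f x\<bar> \<le> real n}" for n :: nat
  have "closed (F n)" for n
    unfolding F_def Ball_def
    by (intro closed_Collect_all closed_Collect_imp closed_Collect_le continuous_intros open_Collect_const)
  moreover have "\<Union> (range F) = UNIV"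
  proof -
    have "\<exists>n. f \<in> F n" for f
    proof -
      obtain b where "\<forall>x\<in>D. \<bar>f x\<bar> \<le> b"
        using assms[of f] by (auto simp: bounded_iff)
      moreover obtain n :: nat where "b \<le> real n"
        using real_arch_simple by blast
      ultimately show ?thesis
        unfolding F_def by (intro exI[of _ n]) (auto intro: order_trans)
    qed
    then show ?thesis by blast
  qed
  ultimately have "\<exists>n. interior (F n) \<noteq> {}"
    using Baire_category_alt[of "euclidean :: ('a \<Rightarrow>\<^sub>L real) topology" "range F"]
    by (auto simp: completely_metrizable_space_euclidean)
  then obtain n f0 where "f0 \<in> interior (F n)" by blast
  then obtain r where r: "0 < r" "ball f0 r \<subseteq> F n"
    by (auto simp: mem_interior)
  have "\<bar>blinfun_apply f x\<bar> \<le> (4 * real n / r) * norm f" if x: "x \<in> D" for f x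
  proof (cases "f = 0")
    case False
    \<comment> \<open>As \<open>g\<close> has norm \<open>r / 2\<close>, both \<open>f0 + g\<close>
      and \<open>f0\<close> lie in the ball. Subtracting their bounds gives \<open>2 * n\<close> for
      \<open>g\<close>, and rescaling gives the factor \<open>4 * n / r\<close>.\<close>
    define g where "g = (r / (2 * norm f)) *\<^sub>R f"
    have "f0 + g \<in> ball f0 r" "f0 \<in> ball f0 r"
      using r(1) False by (simp_all add: g_def dist_norm)
    then have "f0 + g \<in> F n" "f0 \<in> F n"
      using r(2) by blast+
    then have "\<bar>f0 x + g x\<bar> \<le> real n" "\<bar>f0 x\<bar> \<le> real n"
      using x by (auto simp: F_def plus_blinfun.rep_eq)
    then have "\<bar>g x\<bar> \<le> 2 * real n" by linarith
    then show ?thesis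
      using r(1) False by (simp add: g_def scaleR_blinfun.rep_eq abs_mult field_simps)
  qed simp
  then show ?thesis
    using that[of "4 * real n / r"] r(1) by simp
qed

text \<open>Each functional is bounded on the compact set \<open>D\<close>, so uniform boundedness
  applies. The norm is then recovered from explicit functionals attached to paths.\<close>

lemma weakly_compact_james_bounded:
  fixes D :: "james set"
  assumes "weakly_compact D"
  obtains M where "\<And>x. x \<in> D \<Longrightarrow> norm x \<le> M"
proof -
  have "bounded (f ` D)" for f :: "james \<Rightarrow>\<^sub>L real"
  proof -
    have "continuous_map weak_topology euclidean f"
      unfolding continuous_map_def using openin_weak_vimage[of _ f]
      by (auto simp: vimage_def)
    then have "compactin euclidean (f ` D)"
      using assms unfolding weakly_compact_def by (intro image_compactin)
    then show ?thesis
      by (simp add: compact_imp_bounded)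
  qed
  then obtain C where C: "0 \<le> C" "\<And>(f :: james \<Rightarrow>\<^sub>L real) x. x \<in> D \<Longrightarrow> \<bar>blinfun_apply f x\<bar> \<le> C * norm f"
    using pointwise_bounded_imp_bounded by metis
  have "norm x \<le> C" if x: "x \<in> D" for x
    unfolding norm_james.rep_eq
  proof (rule james_norm_least)
    fix p n assume p: "strict_mono_on {..n} (p :: nat \<Rightarrow> nat)"
    let ?d = "\<lambda>y j. james_nth y (p (Suc j)) - james_nth y (p j)"
    let ?l = "james_l2 (james_nth x) p n"
    \<comment> \<open>Pairing with the increments of \<open>x\<close> along \<open>p\<close> almost
      norms \<open>x\<close>: the value at \<open>x\<close> is the square of \<open>?l\<close>,
      while Cauchy-Schwarz bounds the norm of \<open>h\<close> by \<open>?l\<close>.\<close>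
    define h where "h = (\<Sum>j<n. ?d x j *\<^sub>R (james_coord (p (Suc j)) - james_coord (p j)))"
    have h: "h y = (\<Sum>j<n. ?d x j * ?d y j)" for y
      by (simp add: h_def blinfun.sum_left blinfun.diff_left blinfun.scaleR_left james_coord.rep_eq)
    have "norm h \<le> ?l"
    proof (rule norm_blinfun_bound)
      fix y
      have "norm (h y) \<le> (\<Sum>j<n. \<bar>?d x j\<bar> * \<bar>?d y j\<bar>)"
        unfolding h real_norm_def by (rule order_trans[OF sum_abs]) (simp add: abs_mult)
      also have "\<dots> \<le> ?l * james_l2 (james_nth y) p n"
        unfolding james_l2_def by (rule L2_set_mult_ineq)
      also have "\<dots> \<le> ?l * norm y"
        by (intro mult_left_mono james_l2_le_norm p) simp
      finally show "norm (h y) \<le> ?l * norm y" .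
    qed simp
    have "?l * ?l = h x"
      using james_l2_power2[of "james_nth x" p n] by (simp add: h power2_eq_square)
    also have "\<dots> \<le> C * norm h"
      using C(2)[OF x, of h] by simp
    also have "\<dots> \<le> C * ?l"
      using \<open>norm h \<le> ?l\<close> C(1) by (rule mult_left_mono)
    finally show "?l \<le> C"
      using C(1) james_l2_nonneg[of "james_nth x" p n] by (cases "?l = 0") auto
  qed
  then show ?thesis
    using that by blast
qed

section \<open>Block averages\<close>

lemma sum_disjoint_jumps_le:
  assumes "\<And>k. a k < b k" "\<And>k. b k < a (Suc k)"
  shows "(\<Sum>k<N. (james_nth x (b k) - james_nth x (a k))\<^sup>2) \<le> (norm x)\<^sup>2"
proof -
  \<comment> \<open>The points \<open>a k\<close> and \<open>b k\<close> interleave to one path, and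
    the given jumps are its increments of even index.\<close>
  define P where "P j = (if even j then a (j div 2) else b (j div 2))" for j
  have "strict_mono P"
    unfolding strict_mono_Suc_iff P_def using assms by auto
  then have P: "strict_mono_on {..2 * N} P"
    by (auto simp: strict_mono_on_def strict_mono_def)
  let ?d = "\<lambda>j. (james_nth x (P (Suc j)) - james_nth x (P j))\<^sup>2"
  have "(\<Sum>k<N. (james_nth x (b k) - james_nth x (a k))\<^sup>2) = (\<Sum>k<N. ?d (2 * k))"
    by (simp add: P_def)
  also have "\<dots> = sum ?d ((*) 2 ` {..<N})"
    by (subst sum.reindex) (auto intro: inj_onI)
  also have "\<dots> \<le> sum ?d {..<2 * N}"
    by (rule sum_mono2) auto
  also have "\<dots> \<le> (norm x)\<^sup>2"
    unfolding james_l2_power2[symmetric] by (intro power_mono james_l2_le_norm P) simp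
  finally show ?thesis .
qed

text \<open>Null sequences are small at some index from \<open>q\<close> on, so the weakly open sets
  given by these indices cover \<open>D\<close>, and finitely many suffice. The bound
  \<open>q + 2\<close> leaves room for an index strictly between \<open>q\<close> and
  \<open>r\<close>.\<close>

lemma weakly_compact_small_coord:
  assumes "weakly_compact D" "0 < e"
  shows "\<exists>r \<ge> q + 2. \<forall>x\<in>D. \<exists>i\<in>{q..<r}. \<bar>james_nth x i\<bar> < e"
proof -
  let ?U = "\<lambda>i. james_coord i -` {-e<..<e}"
  have cover: "D \<subseteq> \<Union> (?U ` {q..})"
  proof
    fix x assume "x \<in> D"
    obtain N where "\<And>i. N \<le> i \<Longrightarrow> \<bar>james_nth x i\<bar> < e"
      using LIMSEQ_D[OF james_nth_tendsto \<open>0 < e\<close>, of x] by auto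
    then have "\<bar>james_nth x (max N q)\<bar> < e" by simp
    then have "x \<in> ?U (max N q)"
      by (auto simp: james_coord.rep_eq)
    then show "x \<in> \<Union> (?U ` {q..})" by fastforce
  qed
  have "\<exists>\<F>. finite \<F> \<and> \<F> \<subseteq> ?U ` {q..} \<and> D \<subseteq> \<Union> \<F>"
    by (rule compactinD[OF assms(1)[unfolded weakly_compact_def] _ cover])
      (auto intro: openin_weak_vimage)
  then obtain \<F> where F: "finite \<F>" "\<F> \<subseteq> ?U ` {q..}" "D \<subseteq> \<Union> \<F>"
    by (elim exE conjE)
  obtain J where J: "J \<subseteq> {q..}" "finite J" "\<F> = ?U ` J"
    using finite_subset_image[OF F(1,2)] by (elim exE conjE)
  obtain m where m: "\<forall>i\<in>J. i < m"
    using J(2) finite_nat_set_iff_bounded by blast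
  have "\<exists>i\<in>{q..<max m (q + 2)}. \<bar>james_nth x i\<bar> < e" if "x \<in> D" for x
  proof -
    obtain i where "i \<in> J" "x \<in> ?U i"
      using F(3) J(3) \<open>x \<in> D\<close> by blast
    then show ?thesis
      using J(1) m by (intro bexI[of _ i]) (auto simp: james_coord.rep_eq)
  qed
  then show ?thesis
    by (intro exI[of _ "max m (q + 2)"]) simp
qed

text \<open>
  Choose \<open>t\<close> so that each element of \<open>D\<close> is below \<open>c\<close> somewhere in each interval from \<open>t k\<close> to
  \<open>t (Suc k)\<close>. Whenever it exceeds \<open>2 * c\<close> at \<open>t k\<close>, it makes a jump of size \<open>c\<close> within that interval,
  which the norm bound allows only boundedly often. Hence the average over \<open>t 0, \<dots>, t (N - 1)\<close>
  is small for large \<open>N\<close>.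
\<close>
lemma weakly_compact_small_average:
  assumes D: "weakly_compact D" and "0 < e"
  shows "\<exists>I. finite I \<and> I \<noteq> {} \<and> I \<subseteq> {m..} \<and> (\<forall>x\<in>D. \<bar>(\<Sum>i\<in>I. james_nth x i) / card I\<bar> \<le> e)"
proof -
  \<comment> \<open>Two thirds of \<open>e\<close> are spent on a bound valid at every good index,
    one third on the contribution of the bad ones.\<close>
  define c where "c = e / 3"
  have "0 < c" using \<open>0 < e\<close> by (simp add: c_def)
  obtain M where M: "\<And>x. x \<in> D \<Longrightarrow> norm x \<le> M"
    using weakly_compact_james_bounded[OF D] by blast
  obtain r where r: "\<And>q. q + 2 \<le> r q"
      "\<And>q x. x \<in> D \<Longrightarrow> \<exists>i\<in>{q..<r q}. \<bar>james_nth x i\<bar> < c"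
    using weakly_compact_small_coord[OF D \<open>0 < c\<close>] by metis
  define t where "t k = (r ^^ k) m" for k
  have t_Suc: "t (Suc k) = r (t k)" for k
    by (simp add: t_def)
  have "t k < t (Suc k)" for k
    using r(1)[of "t k"] by (simp add: t_Suc)
  then have t_mono: "strict_mono t"
    by (simp add: strict_mono_Suc_iff)
  have inj: "inj_on t A" for A
    using strict_mono_on_imp_inj_on[OF t_mono] by (rule inj_on_subset) simp
  \<comment> \<open>There will be at most \<open>M^2 / c^2\<close> bad indices, each contributing at
    most \<open>M\<close>; this total has to stay below \<open>c * N\<close>.\<close>
  obtain N0 :: nat where N0: "M ^ 3 / c ^ 3 \<le> real N0"
    using real_arch_simple by blast
  define N where "N = Suc N0"
  have N: "M ^ 3 / c\<^sup>2 \<le> c * real N"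
    using N0 \<open>0 < c\<close> by (simp add: N_def field_simps power2_eq_square power3_eq_cube)
      (smt (verit) mult_pos_pos)
  have avg: "\<bar>(\<Sum>i\<in>t ` {..<N}. james_nth x i) / card (t ` {..<N})\<bar> \<le> e" if x: "x \<in> D" for x
  proof -
    let ?x = "james_nth x"
    have Mx: "norm x \<le> M" "0 \<le> M"
      using M[OF x] norm_ge_zero[of x] by linarith+
    define Bad where "Bad = {k \<in> {..<N}. 2 * c < \<bar>?x (t k)\<bar>}"
    \<comment> \<open>At a bad \<open>k\<close> the value falls from above \<open>2 * c\<close> to
      below \<open>c\<close> in modulus. At the others \<open>Suc (t k)\<close> merely fills the
      place, so that \<open>sum_disjoint_jumps_le\<close> applies.\<close>
    have "\<exists>i. t k < i \<and> i < t (Suc k) \<and> (k \<in> Bad \<longrightarrow> c \<le> \<bar>?x i - ?x (t k)\<bar>)" for k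
    proof (cases "k \<in> Bad")
      case True
      obtain i where i: "t k \<le> i" "i < t (Suc k)" "\<bar>?x i\<bar> < c"
        using r(2)[OF x, of "t k"] by (auto simp: t_Suc)
      with True have "c \<le> \<bar>?x i - ?x (t k)\<bar>"
        unfolding Bad_def by auto
      moreover from this have "i \<noteq> t k"
        using \<open>0 < c\<close> by auto
      ultimately show ?thesis
        using i by (intro exI[of _ i]) auto
    next
      case False
      then show ?thesis
        using r(1)[of "t k"] by (intro exI[of _ "Suc (t k)"]) (auto simp: t_Suc)
    qed
    then obtain b where b: "\<And>k. t k < b k" "\<And>k. b k < t (Suc k)"
        "\<And>k. k \<in> Bad \<Longrightarrow> c \<le> \<bar>?x (b k) - ?x (t k)\<bar>"
      by metis
    have "real (card Bad) * c\<^sup>2 = (\<Sum>k\<in>Bad. c\<^sup>2)" by simp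
    also have "\<dots> \<le> (\<Sum>k\<in>Bad. (?x (b k) - ?x (t k))\<^sup>2)"
      using b(3) \<open>0 < c\<close> by (intro sum_mono) (simp add: abs_le_square_iff[symmetric])
    also have "\<dots> \<le> (\<Sum>k<N. (?x (b k) - ?x (t k))\<^sup>2)"
      by (rule sum_mono2) (auto simp: Bad_def)
    also have "\<dots> \<le> (norm x)\<^sup>2"
      by (rule sum_disjoint_jumps_le) (rule b)+
    also have "\<dots> \<le> M\<^sup>2"
      using Mx by (intro power_mono) auto
    finally have "real (card Bad) \<le> M\<^sup>2 / c\<^sup>2"
      using \<open>0 < c\<close> by (simp add: field_simps)
    from mult_right_mono[OF this Mx(2)] have card: "real (card Bad) * M \<le> M ^ 3 / c\<^sup>2"
      by (simp add: power2_eq_square power3_eq_cube)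
    have "\<bar>\<Sum>i\<in>t ` {..<N}. ?x i\<bar> = \<bar>\<Sum>k<N. ?x (t k)\<bar>"
      by (simp add: sum.reindex[OF inj])
    also have "\<dots> \<le> (\<Sum>k<N. 2 * c + (if k \<in> Bad then M else 0))"
    proof (rule order_trans[OF sum_abs], rule sum_mono)
      fix k assume "k \<in> {..<N}"
      then show "\<bar>?x (t k)\<bar> \<le> 2 * c + (if k \<in> Bad then M else 0)"
        using order_trans[OF abs_james_nth_le_norm Mx(1), of "t k"] \<open>0 < c\<close> by (auto simp: Bad_def)
    qed
    also have "\<dots> = real N * (2 * c) + real (card Bad) * M"
    proof -
      have "(\<Sum>k<N. if k \<in> Bad then M else 0) = (\<Sum>k\<in>Bad. M)"
        by (rule sum.mono_neutral_cong_right) (auto simp: Bad_def)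
      then show ?thesis by (simp add: sum.distrib)
    qed
    also have "\<dots> \<le> real N * e"
    proof -
      have "e = 3 * c" by (simp add: c_def)
      then show ?thesis
        using card N by (simp add: algebra_simps)
    qed
    finally show ?thesis
      by (simp add: card_image[OF inj] N_def field_simps)
  qed
  have "m \<le> t k" for k
    using strict_mono_leD[OF t_mono, of 0 k] by (simp add: t_def)
  then show ?thesis
    using avg by (intro exI[of _ "t ` {..<N}"]) (auto simp: N_def)
qed

section \<open>Successive blocks and averaging over them\<close>

definition successive :: "(nat \<Rightarrow> nat set) \<Rightarrow> bool"
  where "successive I \<longleftrightarrow>
    (\<forall>k. finite (I k) \<and> I k \<noteq> {} \<and> (\<forall>i\<in>I k. \<forall>j\<in>I (Suc k). i < j))"

text \<open>Since no block is empty, the order between neighbouring blocks is transitive.\<close>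

lemma successive_less:
  assumes I: "successive I" and "k < l" "i \<in> I k" "j \<in> I l"
  shows "i < j"
  using assms(2,4)
proof (induction l arbitrary: j)
  case (Suc l)
  obtain i' where "i' \<in> I l"
    using I by (metis successive_def ex_in_conv)
  then have "i \<le> i'" if "k < l"
    using Suc.IH[OF that] by (auto intro: less_imp_le)
  moreover have "i' < j" if "i' \<in> I l" for i'
    using I Suc.prems that by (auto simp: successive_def)
  ultimately show ?case
    using Suc.prems(1) \<open>i' \<in> I l\<close> assms(3) by (metis le_less_trans less_antisym)
qed simp

text \<open>The blocks move off to infinity, so that averages inherit the limit of the
  sequence.\<close>

lemma successive_ge: "successive I \<Longrightarrow> i \<in> I k \<Longrightarrow> k \<le> i"
proof (induction k arbitrary: i)
  case (Suc k)
  obtain i' where "i' \<in> I k"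
    using Suc.prems(1) by (metis successive_def ex_in_conv)
  then show ?case
    using Suc.IH[OF Suc.prems(1), of i'] successive_less[OF Suc.prems(1) lessI, of i' k i] Suc.prems(2)
    by simp
qed simp

definition block_avg :: "(nat \<Rightarrow> nat set) \<Rightarrow> (nat \<Rightarrow> real) \<Rightarrow> nat \<Rightarrow> real"
  where "block_avg I x k = (\<Sum>i\<in>I k. x i) / card (I k)"

text \<open>
  By convexity in each single value, averages may be replaced one after the other by values of \<open>x\<close>
  at points of the blocks, that is, by the variation of \<open>x\<close> along a path.
\<close>
lemma james_l2_block_avg:
  assumes I: "successive I"
    and B: "\<And>p n. strict_mono_on {..n} p \<Longrightarrow> james_l2 x p n \<le> B"
    and p: "strict_mono_on {..n} p"
  shows "james_l2 (block_avg I x) p n \<le> B"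
proof -
  have fin: "finite (I k)" "I k \<noteq> {}" for k
    using I by (auto simp: successive_def)
  \<comment> \<open>The first \<open>m\<close> values are averages, the others are values at
    representatives \<open>t\<close>. For \<open>m = 0\<close> the representatives form an
    increasing path.\<close>
  have avg: "james_l2 (\<lambda>j. if j < m then block_avg I x (p j) else x (t j)) id n \<le> B"
    if "\<And>j. t j \<in> I (p j)" for m t
    using that
  proof (induction m arbitrary: t)
    case 0
    have "strict_mono_on {..n} t"
      using p successive_less[OF I _ 0 0] by (auto simp: strict_mono_on_def)
    then show ?case
      using B[of n t] by (simp add: james_l2_def)
  next
    case (Suc m)
    let ?c = "1 / real (card (I (p m)))"
    let ?z = "\<lambda>i j. if j < m then block_avg I x (p j) else x ((t(m := i)) j)"
    have card: "0 < card (I (p m))"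
      using fin by (simp add: card_gt_0_iff)
    \<comment> \<open>Averaging at place \<open>m\<close> is a convex combination of sequences with
      \<open>i\<close> as representative there; at all other places these sequences agree.\<close>
    have eq: "(\<lambda>j. if j < Suc m then block_avg I x (p j) else x (t j)) = (\<lambda>j. \<Sum>i\<in>I (p m). ?c * ?z i j)"
    proof
      fix j
      consider "j < m" | "j = m" | "m < j" by linarith
      then show "(if j < Suc m then block_avg I x (p j) else x (t j)) = (\<Sum>i\<in>I (p m). ?c * ?z i j)"
      proof cases
        case 2
        then show ?thesis by (simp add: block_avg_def sum_divide_distrib)
      qed (use card in auto)
    qed
    have "james_l2 (\<lambda>j. \<Sum>i\<in>I (p m). ?c * ?z i j) id n \<le> (\<Sum>i\<in>I (p m). james_l2 (\<lambda>j. ?c * ?z i j) id n)"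
      by (rule james_l2_sum[OF fin(1)])
    also have "\<dots> \<le> (\<Sum>i\<in>I (p m). ?c * B)"
    proof (rule sum_mono)
      fix i assume "i \<in> I (p m)"
      then have "james_l2 (?z i) id n \<le> B"
        using Suc.prems by (intro Suc.IH) auto
      then show "james_l2 (\<lambda>j. ?c * ?z i j) id n \<le> ?c * B"
        unfolding james_l2_scale by (simp add: divide_right_mono)
    qed
    also have "\<dots> = B"
      using card by simp
    finally show ?case
      by (simp only: eq)
  qed
  have "(SOME i. i \<in> I (p j)) \<in> I (p j)" for j
    using fin(2) by (simp add: some_in_eq)
  \<comment> \<open>A path with \<open>n\<close> increments has \<open>Suc n\<close> points, all of
    which are to be averaged.\<close>
  from avg[of "\<lambda>j. SOME i. i \<in> I (p j)", OF this, of "Suc n"] have "james_l2 (\<lambda>j. block_avg I x (p j)) id n \<le> B"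
    by (subst james_l2_cong[where y = "\<lambda>j. if j < Suc n then block_avg I x (p j)
        else x (SOME i. i \<in> I (p j))"]) auto
  then show ?thesis
    by (simp add: james_l2_comp)
qed

lemma block_avg_tendsto:
  assumes I: "successive I" and x: "x \<longlonglongrightarrow> L"
  shows "block_avg I x \<longlonglongrightarrow> L"
proof (rule LIMSEQ_I)
  fix e :: real assume "0 < e"
  then have "0 < e / 2" by simp
  then obtain N where N: "\<And>i. N \<le> i \<Longrightarrow> \<bar>x i - L\<bar> < e / 2"
    using LIMSEQ_D[OF x] by (metis real_norm_def)
  have "norm (block_avg I x k - L) < e" if "N \<le> k" for k
  proof -
    have card: "0 < card (I k)"
      using I by (auto simp: successive_def card_gt_0_iff)
    then have "\<bar>block_avg I x k - L\<bar> = \<bar>\<Sum>i\<in>I k. x i - L\<bar> / card (I k)"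
      by (simp add: block_avg_def sum_subtractf field_simps abs_divide)
    also have "\<dots> \<le> (card (I k) * (e / 2)) / card (I k)"
    proof (intro divide_right_mono order_trans[OF sum_abs] sum_bounded_above)
      fix i assume "i \<in> I k"
      then show "\<bar>x i - L\<bar> \<le> e / 2"
        by (intro less_imp_le N order_trans[OF that successive_ge[OF I]])
    qed simp
    also have "\<dots> < e"
      using card \<open>0 < e\<close> by simp
    finally show ?thesis by simp
  qed
  then show "\<exists>N. \<forall>k\<ge>N. norm (block_avg I x k - L) < e" by blast
qed

section \<open>The operator subtracting block averages\<close>

lemma block_avg_add: "block_avg I (\<lambda>i. x i + y i) k = block_avg I x k + block_avg I y k"
  by (simp add: block_avg_def sum.distrib add_divide_distrib)

lemma block_avg_scale: "block_avg I (\<lambda>i. c * x i) k = c * block_avg I x k"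
  by (simp add: block_avg_def sum_distrib_left)

text \<open>Defined on all sequences, so that it can be applied to the bidual. The value is
  meaningful once the difference is known to lie in James' space, see
  \<open>james_nth_minus_avg\<close>.\<close>

definition minus_avg :: "(nat \<Rightarrow> nat set) \<Rightarrow> (nat \<Rightarrow> real) \<Rightarrow> james"
  where "minus_avg I x = Abs_james (\<lambda>k. x k - block_avg I x k)"

lemma james_l2_minus_avg:
  assumes "successive I" "\<And>p n. strict_mono_on {..n} p \<Longrightarrow> james_l2 x p n \<le> B" "strict_mono_on {..n} p"
  shows "james_l2 (\<lambda>k. x k - block_avg I x k) p n \<le> 2 * B"
proof -
  have "james_l2 (\<lambda>k. x k - block_avg I x k) p n
      \<le> james_l2 x p n + james_l2 (\<lambda>k. (- 1) * block_avg I x k) p n"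
    using james_l2_add[of x "\<lambda>k. (- 1) * block_avg I x k" p n] by simp
  also have "\<dots> \<le> B + B"
    using assms(2)[OF assms(3)] james_l2_block_avg[OF assms]
    by (simp only: james_l2_scale abs_minus_cancel abs_one mult_1 add_mono)
  finally show ?thesis by simp
qed

text \<open>As \<open>x\<close> and its block averages have the same limit, a null sequence remains.\<close>
lemma james_nth_minus_avg:
  assumes "successive I" "\<And>p n. strict_mono_on {..n} p \<Longrightarrow> james_l2 x p n \<le> B"
  shows "james_nth (minus_avg I x) k = x k - block_avg I x k"
proof -
  obtain L where L: "x \<longlonglongrightarrow> L"
    using bdd_james_sums_imp_convergent[OF bdd_james_sumsI[OF assms(2)]] by (auto simp: convergent_def)
  have "(\<lambda>k. x k - block_avg I x k) \<longlonglongrightarrow> L - L"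
    by (intro tendsto_diff L block_avg_tendsto assms(1))
  moreover have "bdd_above (james_sums (\<lambda>k. x k - block_avg I x k))"
    by (rule bdd_james_sumsI) (rule james_l2_minus_avg[OF assms])
  ultimately show ?thesis
    by (simp add: minus_avg_def Abs_james_inverse)
qed

lemma norm_minus_avg_le:
  assumes "successive I" "\<And>p n. strict_mono_on {..n} p \<Longrightarrow> james_l2 x p n \<le> B"
  shows "norm (minus_avg I x) \<le> 2 * B"
  unfolding norm_james.rep_eq
proof (rule james_norm_least)
  fix p n assume "strict_mono_on {..n} (p :: nat \<Rightarrow> nat)"
  from james_l2_minus_avg[OF assms this] show "james_l2 (james_nth (minus_avg I x)) p n \<le> 2 * B"
    by (subst james_l2_cong[where y = "\<lambda>k. x k - block_avg I x k"]) (auto simp: james_nth_minus_avg[OF assms])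
qed

text \<open>The default 0 makes this a bounded operator for every \<open>I\<close>, as the lifting
  requires.\<close>

lift_definition minus_avg_op :: "(nat \<Rightarrow> nat set) \<Rightarrow> james \<Rightarrow>\<^sub>L james"
  is "\<lambda>I x. if successive I then minus_avg I (james_nth x) else 0"
proof (intro bounded_linear_intro[of _ 2])
  fix I :: "nat \<Rightarrow> nat set" and x y :: james and c :: real
  note nth = james_nth_minus_avg[OF _ james_l2_le_norm]
  let ?V = "\<lambda>x. if successive I then minus_avg I (james_nth x) else 0"
  show "?V (x + y) = ?V x + ?V y"
    by (auto intro!: james_eqI) (simp add: nth[of I "x + y", simplified] nth block_avg_add)
  show "?V (c *\<^sub>R x) = c *\<^sub>R ?V x"
    by (auto intro!: james_eqI) (simp add: nth[of I "c *\<^sub>R x", simplified] nth block_avg_scale right_diff_distrib)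
  show "norm (?V x) \<le> norm x * 2"
    using norm_minus_avg_le[OF _ james_l2_le_norm, of I x] by (simp add: mult.commute)
qed

text \<open>The set \<open>K\<close> below contains the unit ball of the bidual of James' space.\<close>
lemma weakly_compact_minus_avg_op:
  assumes I: "successive I"
  shows "weakly_compact_operator (minus_avg_op I)"
proof -
  define K where "K = {x :: nat \<Rightarrow> real. (\<forall>i. x i \<in> {-1..1}) \<and>
    (\<forall>p n. strict_mono_on {..n} p \<longrightarrow> james_l2 x p n \<le> 1)}"
  \<comment> \<open>By Tychonoff the box is compact in the product topology. The variation bounds
    cut out a closed subset, each involving finitely many coordinates.\<close>
  have "compact (PiE UNIV (\<lambda>_. {-1..1}) :: (nat \<Rightarrow> real) set)"
    using compactin_PiE[of "\<lambda>_. euclidean :: real topology" UNIV "\<lambda>_. {-1..1}"]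
    by (simp add: euclidean_product_topology)
  moreover have "closed {x :: nat \<Rightarrow> real. \<forall>p n. strict_mono_on {..n} p \<longrightarrow> james_l2 x p n \<le> 1}"
    unfolding james_l2_def L2_set_def
    by (intro closed_Collect_all closed_Collect_imp closed_Collect_le open_Collect_const continuous_intros)
      simp_all
  moreover have "K = PiE UNIV (\<lambda>_. {-1..1}) \<inter>
      {x. \<forall>p n. strict_mono_on {..n} p \<longrightarrow> james_l2 x p n \<le> 1}"
    by (auto simp: K_def PiE_UNIV_domain)
  ultimately have "compact K"
    by (simp add: compact_Int_closed)
  moreover have l2: "james_l2 x p n \<le> 1" if "x \<in> K" "strict_mono_on {..n} p" for x p n
    using that by (simp add: K_def)
  moreover have "continuous_on K (\<lambda>x. james_nth (minus_avg I x) i)" for i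
  proof -
    \<comment> \<open>Blocks are finite, so each coordinate of the image depends on finitely many
      coordinates of \<open>x\<close>.\<close>
    have "continuous_on K (\<lambda>x. x i - block_avg I x i)"
      unfolding block_avg_def by (intro continuous_intros continuous_on_subset[OF continuous_on_product_coordinates])
        (use I in \<open>auto simp: successive_def\<close>)
    then show ?thesis
      by (rule continuous_on_eq) (simp add: james_nth_minus_avg[OF I l2])
  qed
  ultimately have "weakly_compact (minus_avg I ` K)"
    using norm_minus_avg_le[OF I l2] by (intro weakly_compact_james_image)
  moreover have "blinfun_apply (minus_avg_op I) ` cball 0 1 \<subseteq> minus_avg I ` K"
  proof (clarify, rule image_eqI)
    fix x :: james assume x: "x \<in> cball 0 1"
    show "minus_avg_op I x = minus_avg I (james_nth x)"
      using I by (simp add: minus_avg_op.rep_eq)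
    show "james_nth x \<in> K"
      using x james_l2_le_norm[of _ _ x] abs_james_nth_le_norm[of x]
      by (auto simp: K_def abs_le_iff intro: order_trans) (smt (verit))+
  qed
  ultimately show ?thesis
    unfolding weakly_compact_operator_def by (rule weakly_compact_closure_james)
qed

lemma james_nth_minus_avg_op:
  "successive I \<Longrightarrow> james_nth (minus_avg_op I x) k = james_nth x k - block_avg I (james_nth x) k"
  by (simp add: minus_avg_op.rep_eq james_nth_minus_avg[OF _ james_l2_le_norm])

lemma norm_minus_avg_op_le: "successive I \<Longrightarrow> norm (minus_avg_op I) \<le> 2"
  by (rule norm_blinfun_bound)
    (simp_all add: minus_avg_op.rep_eq norm_minus_avg_le[OF _ james_l2_le_norm])

section \<open>Blocks adapted to a weakly compact set, and the conclusion\<close>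

lemma ex_successive_small_block_avg:
  assumes "weakly_compact D" "0 < d"
  obtains I where "successive I"
    "\<And>k x. x \<in> D \<Longrightarrow> \<bar>block_avg I (james_nth x) k\<bar> \<le> d * (1 / 2) ^ k"
proof -
  define P where "P k J \<longleftrightarrow> finite J \<and> J \<noteq> {} \<and>
    (\<forall>x\<in>D. \<bar>(\<Sum>i\<in>J. james_nth x i) / card J\<bar> \<le> d * (1 / 2) ^ k)" for k J
  have ex: "\<exists>J. P k J \<and> J \<subseteq> {m..}" for k m
    using weakly_compact_small_average[OF assms(1), of "d * (1 / 2) ^ k" m] assms(2)
    by (simp add: P_def conj_ac)
  \<comment> \<open>Dependent choice: each block is taken beyond the maximum of the one
    before.\<close>
  have "\<exists>I. \<forall>k. P k (I k) \<and> (\<forall>i\<in>I k. \<forall>j\<in>I (Suc k). i < j)"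
  proof (rule dependent_nat_choice)
    show "\<exists>J. P 0 J"
      using ex by blast
    fix J k assume "P k J"
    then have "finite J"
      by (simp add: P_def)
    obtain J' where J': "P (Suc k) J'" "J' \<subseteq> {Suc (Max J)..}"
      using ex by blast
    have "i < j" if "i \<in> J" "j \<in> J'" for i j
      using J'(2) that \<open>finite J\<close> by (meson Max_ge Suc_le_lessD atLeast_iff le_less_trans subsetD)
    then show "\<exists>J'. P (Suc k) J' \<and> (\<forall>i\<in>J. \<forall>j\<in>J'. i < j)"
      using J'(1) by blast
  qed
  then obtain I where "\<And>k. P k (I k)" "\<And>k. \<forall>i\<in>I k. \<forall>j\<in>I (Suc k). i < j"
    by blast
  then show ?thesis
    by (intro that[of I]) (simp_all add: P_def successive_def block_avg_def)
qed

text \<open>Since \<open>j <= p j\<close> along a path, the \<open>j\<close>-th increment is at most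
  \<open>2 * d / 2^j\<close>. The l2 sum is bounded by the l1 sum, a geometric series with total
  below \<open>4 * d\<close>.\<close>

lemma norm_james_le_of_geometric:
  assumes "0 \<le> d" "\<And>k. \<bar>james_nth x k\<bar> \<le> d * (1 / 2) ^ k"
  shows "norm x \<le> 4 * d"
  unfolding norm_james.rep_eq
proof (rule james_norm_least)
  fix p n assume p: "strict_mono_on {..n} (p :: nat \<Rightarrow> nat)"
  have ge: "j \<le> p j" if "j \<le> n" for j
    using that
  proof (induction j)
    case (Suc j)
    then show ?case
      using strict_mono_onD[OF p, of j "Suc j"] by simp
  qed simp
  have le: "\<bar>james_nth x (p i)\<bar> \<le> d * (1 / 2) ^ j" if "j \<le> i" "i \<le> n" for i j
    using assms(2)[of "p i"] mult_left_mono[OF power_decreasing[of j "p i" "1 / 2 :: real"] assms(1)]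
      ge[OF that(2)] that(1) by simp
  have "james_l2 (james_nth x) p n \<le> (\<Sum>j<n. 2 * d * (1 / 2) ^ j)"
    unfolding james_l2_def
  proof (rule order_trans[OF L2_set_le_sum_abs], rule sum_mono)
    fix j assume "j \<in> {..<n}"
    then show "\<bar>james_nth x (p (Suc j)) - james_nth x (p j)\<bar> \<le> 2 * d * (1 / 2) ^ j"
      using le[of j "Suc j"] le[of j j] by simp
  qed
  also have "\<dots> = 2 * d * (\<Sum>j<n. (1 / 2) ^ j)"
    by (simp add: sum_distrib_left)
  also have "\<dots> \<le> 2 * d * 2"
    using assms(1) by (intro mult_left_mono) (simp_all add: geometric_sum)
  finally show "james_l2 (james_nth x) p n \<le> 4 * d" by simp
qed

theorem theorem2p2:
  shows "WAP TYPE(james)"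
  unfolding WAP_def
proof (intro exI[of _ 2] allI impI)
  fix D :: "james set" and \<epsilon> :: real
  assume D: "weakly_compact D" and "\<epsilon> > 0"
  \<comment> \<open>With \<open>\<epsilon> / 8\<close> the geometric bound yields
    \<open>\<epsilon> / 2\<close>, which keeps the supremum strictly below
    \<open>\<epsilon>\<close>.\<close>
  then obtain I where I: "successive I"
      "\<And>k x. x \<in> D \<Longrightarrow> \<bar>block_avg I (james_nth x) k\<bar> \<le> \<epsilon> / 8 * (1 / 2) ^ k"
    using ex_successive_small_block_avg[of D "\<epsilon> / 8"] by auto
  let ?V = "minus_avg_op I"
  have "norm (x - ?V x) \<le> \<epsilon> / 2" if "x \<in> D" for x
    using norm_james_le_of_geometric[of "\<epsilon> / 8" "x - ?V x"] I(2)[OF that] \<open>\<epsilon> > 0\<close>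
    by (simp add: james_nth_minus_avg_op[OF I(1)])
  then have "(SUP x\<in>D. ereal (norm (x - ?V x))) \<le> ereal (\<epsilon> / 2)"
    by (intro SUP_least) simp
  also have "\<dots> < ereal \<epsilon>"
    using \<open>\<epsilon> > 0\<close> by simp
  finally show "\<exists>V. weakly_compact_operator V \<and>
      (SUP x\<in>D. ereal (norm (x - blinfun_apply V x))) < ereal \<epsilon> \<and> norm V \<le> 2"
    using weakly_compact_minus_avg_op[OF I(1)] norm_minus_avg_op_le[OF I(1)] by blast
qed

end
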